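(* Let $G$ be a connected graph. If $$|E(G)|>1+\max_{P\in\mathbf{P}}\sum_{v\in V(P)}\left(d_{\widehat{G}}(v)-1\right),$$ where $\mathbf{P}$ is the set of all shortest paths in $S(G)$ connecting vertices $w_{ij}$ (subdivision vertices), then $\widehat{G}\notin\mathfrak{N}$.
   Context: All graphs are finite, without loops or multiple edges. An interval $t$-coloring of a graph $H$ is a proper edge-coloring of $H$ with colors $1,\ldots,t$ such that every color is used and for every vertex $v$ the set of colors of edges incident to $v$ is an interval of integers. $\mathfrak{N}$ denotes the set of graphs having an interval $t$-coloring for some positive integer $t$. For a graph $G$ with vertices $v_1,\ldots,v_n$, $S(G)$ is the graph with vertex set $\{v_1,\ldots,v_n\}\cup\{w_{ij}:v_iv_j\in E(G)\}$ and edge set $\{v_iw_{ij},v_jw_{ij}:v_iv_j\in E(G)\}$ (every edge subdivided once). $\widehat{G}$ is obtained from $S(G)$ by adding a new vertex $u$ and the edges $uw_{ij}$ for all $v_iv_j\in E(G)$. $d_{\widehat{G}}(v)$ denotes the degree of $v$ in $\widehat{G}$; $V(P)$ is the vertex set of path $P$. *)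

theory Defs
  imports Main
begin

record 'a ugraph =
  verts :: "'a set"
  edges :: "'a set set"

definition simple_graph :: "'a ugraph \<Rightarrow> bool" where
  "simple_graph G \<longleftrightarrow> finite (verts G) \<and> (\<forall>e\<in>edges G. e \<subseteq> verts G \<and> card e = 2)"

definition degree :: "'a ugraph \<Rightarrow> 'a \<Rightarrow> nat" where
  "degree G v = card {e \<in> edges G. v \<in> e}"

text \<open>A path is given by the list of its vertices; a single vertex is a path of length 0.\<close>

definition path_between :: "'a ugraph \<Rightarrow> 'a \<Rightarrow> 'a list \<Rightarrow> 'a \<Rightarrow> bool" where
  "path_between G x p y \<longleftrightarrow>
     p \<noteq> [] \<and> hd p = x \<and> last p = y \<and> set p \<subseteq> verts G \<and> distinct p \<and>
     (\<forall>i. Suc i < length p \<longrightarrow> {p ! i, p ! Suc i} \<in> edges G)"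

definition shortest_path_between :: "'a ugraph \<Rightarrow> 'a \<Rightarrow> 'a list \<Rightarrow> 'a \<Rightarrow> bool" where
  "shortest_path_between G x p y \<longleftrightarrow>
     path_between G x p y \<and> (\<forall>q. path_between G x q y \<longrightarrow> length p \<le> length q)"

definition connected_graph :: "'a ugraph \<Rightarrow> bool" where
  "connected_graph G \<longleftrightarrow>
     verts G \<noteq> {} \<and> (\<forall>x\<in>verts G. \<forall>y\<in>verts G. \<exists>p. path_between G x p y)"

definition proper_edge_coloring :: "'a ugraph \<Rightarrow> ('a set \<Rightarrow> nat) \<Rightarrow> bool" where
  "proper_edge_coloring H c \<longleftrightarrow>
     (\<forall>e\<in>edges H. \<forall>f\<in>edges H. e \<noteq> f \<and> e \<inter> f \<noteq> {} \<longrightarrow> c e \<noteq> c f)"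

text \<open>The interval at an isolated vertex is empty, which is the case \<^term>\<open>b < a\<close> below.\<close>

definition interval_coloring :: "'a ugraph \<Rightarrow> nat \<Rightarrow> ('a set \<Rightarrow> nat) \<Rightarrow> bool" where
  "interval_coloring H t c \<longleftrightarrow>
     proper_edge_coloring H c \<and> c ` edges H = {1..t} \<and>
     (\<forall>v\<in>verts H. \<exists>a b. c ` {e \<in> edges H. v \<in> e} = {a..b})"

definition interval_colorable :: "'a ugraph set" where
  "interval_colorable = {H. \<exists>t>0. \<exists>c. interval_coloring H t c}"

text \<open>\<open>Subdiv {x, y}\<close> is the vertex subdividing the edge \<open>{x, y}\<close>.\<close>

datatype 'a hat_vertex = Orig 'a | Subdiv "'a set" | Apex

definition subdivision :: "'a ugraph \<Rightarrow> 'a hat_vertex ugraph" where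
  "subdivision G =
     \<lparr>verts = Orig ` verts G \<union> Subdiv ` edges G,
      edges = {{Orig v, Subdiv e} | v e. e \<in> edges G \<and> v \<in> e}\<rparr>"

definition hat_graph :: "'a ugraph \<Rightarrow> 'a hat_vertex ugraph" where
  "hat_graph G =
     \<lparr>verts = insert Apex (verts (subdivision G)),
      edges = edges (subdivision G) \<union> {{Apex, Subdiv e} | e. e \<in> edges G}\<rparr>"

text \<open>The two ends may coincide, so one-vertex paths are included.  Hence the set is nonempty
  as soon as \<open>G\<close> has an edge.\<close>

definition subdiv_shortest_paths :: "'a ugraph \<Rightarrow> 'a hat_vertex list set" where
  "subdiv_shortest_paths G =
     {p. \<exists>e\<in>edges G. \<exists>f\<in>edges G.
           shortest_path_between (subdivision G) (Subdiv e) p (Subdiv f)}"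

end

theory Submission
  imports Defs
begin

text \<open>The edges at the apex carry \<open>|E(G)|\<close> consecutive colours. Join the subdivision vertices
  of the edges with the smallest and the largest of these colours by a shortest path in \<open>S(G)\<close>
  and close it up through the apex. Two consecutive edges of this closed walk meeting in \<open>v\<close> have
  colours differing by at most \<open>d(v) - 1\<close>, so \<open>|E(G)| - 1\<close> is at most the sum of \<open>d(v) - 1\<close>
  over the path.\<close>

lemma interval_coloring_card_image:
  assumes "interval_coloring H t c"
  shows "card (c ` {e \<in> edges H. v \<in> e}) = degree H v"
proof -
  have "inj_on c {e \<in> edges H. v \<in> e}"
    using assms unfolding interval_coloring_def proper_edge_coloring_def inj_on_def by blast
  then show ?thesis
    by (simp add: card_image degree_def)
qed

text \<open>By properness the interval of colours at \<open>v\<close> has exactly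
  \<open>degree H v\<close> elements, so its ends differ by one less. Integers are used because
  either colour may be the larger.\<close>

lemma interval_coloring_diff_le_degree:
  assumes col: "interval_coloring H t c" and v: "v \<in> verts H"
    and g: "g \<in> edges H" "v \<in> g" and h: "h \<in> edges H" "v \<in> h"
  shows "int (c h) - int (c g) \<le> int (degree H v) - 1"
proof -
  obtain a b where ab: "c ` {e \<in> edges H. v \<in> e} = {a..b}"
    using col v unfolding interval_coloring_def by blast
  have "c g \<in> {a..b}" "c h \<in> {a..b}"
    unfolding ab[symmetric] using g h by auto
  moreover have "Suc b - a = degree H v"
    using interval_coloring_card_image[OF col, of v] by (simp add: ab)
  ultimately show ?thesis
    by auto
qed

text \<open>Telescoping: passing through \<open>p ! j\<close> from one edge to the next costs one
  degree term. The edges \<open>g\<close> and \<open>h\<close> need not lie on the walk, so the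
  induction can take the next walk edge for \<open>h\<close>, and apex edges can be attached at both
  ends later.\<close>

lemma interval_coloring_walk_bound:
  assumes col: "interval_coloring H t c" and verts: "set p \<subseteq> verts H"
    and edges: "\<And>i. Suc i < length p \<Longrightarrow> {p ! i, p ! Suc i} \<in> edges H"
    and g: "g \<in> edges H" "p ! 0 \<in> g"
    and "i < length p" "h \<in> edges H" "p ! i \<in> h"
  shows "int (c h) - int (c g) \<le> (\<Sum>j\<le>i. int (degree H (p ! j)) - 1)"
  using assms(6-8)
proof (induction i arbitrary: h)
  case 0
  then have "p ! 0 \<in> verts H"
    using verts by auto
  then show ?case
    using interval_coloring_diff_le_degree[OF col _ g] 0 by simp
next
  case (Suc i)
  have e: "{p ! i, p ! Suc i} \<in> edges H"
    using edges Suc.prems by blast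
  have "int (c {p ! i, p ! Suc i}) - int (c g) \<le> (\<Sum>j\<le>i. int (degree H (p ! j)) - 1)"
    using Suc.IH[OF _ e] Suc.prems by simp
  moreover have "int (c h) - int (c {p ! i, p ! Suc i}) \<le> int (degree H (p ! Suc i)) - 1"
    using verts Suc.prems by (intro interval_coloring_diff_le_degree[OF col _ e]) auto
  ultimately show ?case
    by simp
qed

text \<open>Reachability composes freely, while joined paths may repeat vertices; the removal of
  repetitions is done here once. The relation demands \<open>v \<in> verts H\<close> because edges
  of an arbitrary \<open>H\<close> may leave its vertex set.\<close>

lemma rtranclp_imp_path_between:
  assumes "(\<lambda>u v. {u, v} \<in> edges H \<and> v \<in> verts H)\<^sup>*\<^sup>* x y" and "x \<in> verts H"
  shows "\<exists>p. path_between H x p y"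
  using assms
proof (induction rule: rtranclp_induct)
  case base
  then have "path_between H x [x] x"
    by (simp add: path_between_def)
  then show ?case ..
next
  case (step y z)
  then obtain p where p: "path_between H x p y"
    by blast
  show ?case
  proof (cases "z \<in> set p")
    case True
    \<comment> \<open>The new vertex already lies on the path, so the path is cut off at it.\<close>
    then obtain ys zs where "p = ys @ z # zs"
      by (meson split_list)
    then have split: "p = (ys @ [z]) @ zs"
      by simp
    have "{(ys @ [z]) ! i, (ys @ [z]) ! Suc i} \<in> edges H" if "Suc i < length (ys @ [z])" for i
    proof -
      have "{p ! i, p ! Suc i} \<in> edges H"
        using p that unfolding path_between_def split by simp
      moreover have "p ! i = (ys @ [z]) ! i" "p ! Suc i = (ys @ [z]) ! Suc i"
        unfolding split using that by (simp_all only: nth_append_left Suc_lessD)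
      ultimately show ?thesis
        by simp
    qed
    moreover have "hd (ys @ [z]) = x"
      using p unfolding path_between_def split by (simp add: hd_append split: if_splits)
    ultimately have "path_between H x (ys @ [z]) z"
      using p unfolding path_between_def split by simp
    then show ?thesis ..
  next
    case False
    have "{(p @ [z]) ! i, (p @ [z]) ! Suc i} \<in> edges H" if "Suc i < length (p @ [z])" for i
    proof (cases "Suc i < length p")
      case True
      then show ?thesis
        using p by (simp add: path_between_def nth_append)
    next
      case False
      with that have "Suc i = length p"
        by simp
      moreover from this have "p ! i = y"
        using p by (metis path_between_def last_conv_nth diff_Suc_1)
      ultimately show ?thesis
        using step.hyps by (simp add: nth_append)
    qed
    then have "path_between H x (p @ [z]) z"
      using p False step.hyps unfolding path_between_def by simp
    then show ?thesis ..
  qed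
qed

text \<open>Pick ends \<open>x\<close> of \<open>e\<close> and \<open>y\<close> of \<open>f\<close>,
  and replace each edge of a path from \<open>x\<close> to \<open>y\<close> in \<open>G\<close> by
  two steps through its subdivision vertex.\<close>

lemma subdivision_connects_subdiv:
  assumes G: "simple_graph G" "connected_graph G" and e: "e \<in> edges G" and f: "f \<in> edges G"
  shows "\<exists>p. path_between (subdivision G) (Subdiv e) p (Subdiv f)"
proof -
  define R where "R = (\<lambda>u v. {u, v} \<in> edges (subdivision G) \<and> v \<in> verts (subdivision G))"
  have OS: "R (Orig v) (Subdiv d)" and SO: "R (Subdiv d) (Orig v)"
    if "d \<in> edges G" "v \<in> d" for d v
    using that G(1) by (auto simp: R_def subdivision_def simple_graph_def insert_commute)
  have "e \<noteq> {}" "f \<noteq> {}" "e \<subseteq> verts G" "f \<subseteq> verts G"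
    using G(1) e f by (auto simp: simple_graph_def)
  then obtain x y where x: "x \<in> e" "x \<in> verts G" and y: "y \<in> f" "y \<in> verts G"
    by blast
  then obtain p where p: "path_between G x p y"
    using G(2) by (auto simp: connected_graph_def)
  have walk: "R\<^sup>*\<^sup>* (Orig x) (Orig (p ! i))" if "i < length p" for i
    using that
  proof (induction i)
    case 0
    then show ?case
      using p by (simp add: path_between_def hd_conv_nth)
  next
    case (Suc i)
    let ?d = "{p ! i, p ! Suc i}"
    have "?d \<in> edges G"
      using p Suc.prems by (simp add: path_between_def)
    then have "R (Orig (p ! i)) (Subdiv ?d)" "R (Subdiv ?d) (Orig (p ! Suc i))"
      by (intro OS SO; simp)+
    then show ?case
      using Suc by (meson Suc_lessD rtranclp.rtrancl_into_rtrancl)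
  qed
  have "p \<noteq> []" "p ! (length p - 1) = y"
    using p by (auto simp: path_between_def last_conv_nth)
  then have "R\<^sup>*\<^sup>* (Orig x) (Orig y)"
    using walk[of "length p - 1"] by simp
  then have "R\<^sup>*\<^sup>* (Subdiv e) (Subdiv f)"
    using SO[OF e x(1)] OS[OF f y(1)]
    by (meson converse_rtranclp_into_rtranclp rtranclp.rtrancl_into_rtrancl)
  then show ?thesis
    unfolding R_def by (rule rtranclp_imp_path_between) (use e in \<open>simp add: subdivision_def\<close>)
qed

lemma path_between_imp_shortest:
  assumes "path_between H x p y"
  shows "\<exists>q. shortest_path_between H x q y"
  using exists_least_iff[of "\<lambda>n. \<exists>q. path_between H x q y \<and> length q = n"] assms
  unfolding shortest_path_between_def by (metis linorder_not_less)

lemma simple_graph_finite_edges: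
  assumes "simple_graph G"
  shows "finite (edges G)"
  by (rule finite_subset[of _ "Pow (verts G)"]) (use assms in \<open>auto simp: simple_graph_def\<close>)

text \<open>Needed for \<open>Max\<close> in the theorem to bound the sum of each path.\<close>

lemma finite_subdiv_shortest_paths:
  assumes "simple_graph G"
  shows "finite (subdiv_shortest_paths G)"
proof (rule finite_subset)
  show "subdiv_shortest_paths G \<subseteq> {p. set p \<subseteq> verts (subdivision G) \<and> distinct p}"
    by (auto simp: subdiv_shortest_paths_def shortest_path_between_def path_between_def)
  have "finite (verts (subdivision G))"
    using assms simple_graph_finite_edges[OF assms]
    by (simp add: subdivision_def simple_graph_def)
  then show "finite {p. set p \<subseteq> verts (subdivision G) \<and> distinct p}"
    by (rule finite_subset_distinct)
qed

lemma degree_hat_graph_Apex: "degree (hat_graph G) Apex = card (edges G)"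
proof -
  have "{e \<in> edges (hat_graph G). Apex \<in> e} = (\<lambda>e. {Apex, Subdiv e}) ` edges G"
    by (auto simp: hat_graph_def subdivision_def)
  moreover have "inj_on (\<lambda>e. {Apex, Subdiv e}) (edges G)"
    by (auto simp: inj_on_def doubleton_eq_iff)
  ultimately show ?thesis
    by (simp add: degree_def card_image)
qed

theorem theorem10:
  fixes G :: "'a ugraph"
  assumes "simple_graph G"
    and "connected_graph G"
    and "int (card (edges G)) >
           1 + Max ((\<lambda>P. \<Sum>v\<in>set P. (int (degree (hat_graph G) v) - 1)) ` subdiv_shortest_paths G)"
  shows "hat_graph G \<notin> interval_colorable"
proof
  let ?H = "hat_graph G"
  let ?s = "\<lambda>P. \<Sum>v\<in>set P. (int (degree ?H v) - 1)"
  assume "?H \<in> interval_colorable"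
  then obtain t c where "t > 0" and col: "interval_coloring ?H t c"
    by (auto simp: interval_colorable_def)
  \<comment> \<open>As \<open>t > 0\<close>, some colour is used; this rules out an edgeless
    \<open>G\<close>, for which \<open>{a..b}\<close> below would be empty.\<close>
  then have "edges ?H \<noteq> {}"
    by (auto simp: interval_coloring_def)
  then have "edges G \<noteq> {}"
    by (auto simp: hat_graph_def subdivision_def)
  then have pos: "card (edges G) > 0"
    using simple_graph_finite_edges[OF assms(1)] by (simp add: card_gt_0_iff)
  obtain a b where ab: "c ` {e \<in> edges ?H. Apex \<in> e} = {a..b}"
    using col by (auto simp: interval_coloring_def hat_graph_def)
  have len: "Suc b - a = card (edges G)"
    using interval_coloring_card_image[OF col, of Apex] by (simp add: ab degree_hat_graph_Apex)
  \<comment> \<open>Since \<open>Suc b - a\<close> is positive, \<open>a \<le> b\<close>, so both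
    ends of the interval occur as colours.\<close>
  with pos have "a \<in> c ` {e \<in> edges ?H. Apex \<in> e}" "b \<in> c ` {e \<in> edges ?H. Apex \<in> e}"
    unfolding ab by auto
  then obtain e f where e: "e \<in> edges G" "c {Apex, Subdiv e} = a"
    and f: "f \<in> edges G" "c {Apex, Subdiv f} = b"
    by (auto simp: hat_graph_def subdivision_def)
  obtain p where sp: "shortest_path_between (subdivision G) (Subdiv e) p (Subdiv f)"
    using subdivision_connects_subdiv[OF assms(1,2) e(1) f(1)] path_between_imp_shortest by metis
  then have p: "path_between (subdivision G) (Subdiv e) p (Subdiv f)"
    by (simp add: shortest_path_between_def)
  then have "p \<noteq> []" and ends: "p ! 0 = Subdiv e" "p ! (length p - 1) = Subdiv f"
    and "distinct p"
    by (auto simp: path_between_def hd_conv_nth last_conv_nth)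
  \<comment> \<open>The walk runs in \<open>S(G)\<close>, a subgraph of \<open>?H\<close>;
    \<open>g\<close> and \<open>h\<close> are the apex edges at its two ends.\<close>
  have "int b - int a \<le> (\<Sum>j\<le>length p - 1. int (degree ?H (p ! j)) - 1)"
    unfolding e(2)[symmetric] f(2)[symmetric]
    by (rule interval_coloring_walk_bound[OF col])
      (use p \<open>p \<noteq> []\<close> e f in \<open>auto simp: ends[unfolded One_nat_def] path_between_def hat_graph_def\<close>)
  also have "{..length p - 1} = {..<length p}"
    using \<open>p \<noteq> []\<close> by (cases p) auto
  \<comment> \<open>The path repeats no vertex, so summing over positions is summing over
    \<open>set p\<close>.\<close>
  also have "(\<Sum>j<length p. int (degree ?H (p ! j)) - 1) = ?s p"
    using sum.reindex_bij_betw[OF bij_betw_nth[OF \<open>distinct p\<close> refl refl]] .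
  also have "?s p \<le> Max (?s ` subdiv_shortest_paths G)"
    using sp e f finite_subdiv_shortest_paths[OF assms(1)]
    by (intro Max_ge) (auto simp: subdiv_shortest_paths_def)
  \<comment> \<open>The subtraction in \<open>len\<close> is not truncated, so \<open>b - a\<close>
    is \<open>card (edges G) - 1\<close>.\<close>
  finally show False
    using assms(3) len pos by linarith
qed

end
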